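(* For an ideal $I\subset\mathbf{k}[x]$, $\mathcal{E}(I,\mathcal{U}_{\mathrm{loc}}')=\mathcal{E}(\mathbf{k}[x]_0\, I,\mathcal{U}_{\mathrm{loc}}')$. For an ideal $I\subset D$, $\mathcal{E}(I,\mathcal{W}_{\mathrm{loc}}')=\mathcal{E}(D_{\{0\}}\, I,\mathcal{W}_{\mathrm{loc}}')$.
   Context: Fix $n\ge 1$, a field $\mathbf{k}$ and $x=(x_1,\dots,x_n)$. $\mathbf{k}[x]_0$ is the localization of $\mathbf{k}[x]$ at $0\in\mathbf{k}^n$; its elements are viewed as power series. $D$ and $D_{\{0\}}$ are the rings of differential operators with coefficients in $\mathbf{k}[x]$ and $\mathbf{k}[x]_0$ (generated by the coefficients and $\partial_1,\dots,\partial_n$ with $\partial_ic(x)-c(x)\partial_i=\partial c(x)/\partial x_i$). Ideals in $D,D_{\{0\}}$ are left ideals. $\mathcal{U}_{\mathrm{loc}}'=\{u\in\mathbb{R}^n:u_i<0\ \forall i\}$ and $\mathcal{W}_{\mathrm{loc}}'=\{(u,v)\in\mathbb{R}^{2n}:u_i<0,\ u_i+v_i>0\ \forall i\}$. For nonzero $f=\sum c_\alpha x^\alpha$, $\mathrm{ord}^u(f)=\max\{u\cdot\alpha:c_\alpha\neq0\}$; for nonzero $P=\sum c_{\alpha,\beta}x^\alpha\partial^\beta$ and $w=(u,v)$, $\mathrm{ord}^w(P)=\max\{u\cdot\alpha+v\cdot\beta:c_{\alpha,\beta}\ne0\}$. These orders define filtrations $F_m=\{\mathrm{ord}\le m\}$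 and associated graded rings $\mathrm{gr}=\bigoplus_m F_m/F_{<m}$. The initial form $\mathrm{in}_u(f)$ (resp. $\mathrm{in}_w(P)$) is the class in $F_m/F_{<m}$, $m$ being the order, i.e. the sum of the terms of maximal weight; the initial form of $0$ is $0$. For an ideal $I$, $\mathrm{in}_u(I)$ (resp. $\mathrm{in}_w(I)$) is the ideal of the graded ring generated by the initial forms of all elements of $I$. For $u\in\mathcal{U}_{\mathrm{loc}}'$ the graded rings of $\mathbf{k}[x]$ and $\mathbf{k}[x]_0$ are both identified with $\mathbf{k}[x]$; for $w\in\mathcal{W}_{\mathrm{loc}}'$ those of $D$ and $D_{\{0\}}$ are both identified with the commutative polynomial ring $\mathbf{k}[x_1,\dots,x_n,\xi_1,\dots,\xi_n]$, $\xi_i$ being the class of $\partial_i$. For an ideal $I$ of one of these rings, two weights are equivalent iff the corresponding graded rings are equal and the corresponding initial ideals of $I$ are equal. For a set $U$ of weights, $\mathcal{E}(I,U)$ (open Gröbner fan) denotes the set of equivalence classes of this relation on $U$. (On $\mathcal{U}_{\mathrm{loc}}'$ and $\mathcal{W}_{\mathrm{loc}}'$ the condition on graded rings is automatic.) *)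

theory Defs
  imports "HOL-Analysis.Finite_Cartesian_Product" "HOL-Library.Poly_Mapping" "HOL.Hull"
begin

section \<open>Formal power series in finitely many variables\<close>

text \<open>
  The variables are indexed by a finite type, multi-indices are elements of \<open>'n \<Rightarrow>\<^sub>0 nat\<close>.
\<close>

typedef (overloaded) ('n::finite, 'k) mps = "UNIV :: (('n \<Rightarrow>\<^sub>0 nat) \<Rightarrow> 'k) set"
  morphisms mps_nth Abs_mps ..

setup_lifting type_definition_mps

lemma mps_eqI: "(\<And>\<alpha>. mps_nth f \<alpha> = mps_nth g \<alpha>) \<Longrightarrow> f = g"
  by transfer (rule ext)

definition splits :: "('n::finite \<Rightarrow>\<^sub>0 nat) \<Rightarrow> (('n \<Rightarrow>\<^sub>0 nat) \<times> ('n \<Rightarrow>\<^sub>0 nat)) set"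
  where "splits \<gamma> = {(\<alpha>, \<beta>). \<alpha> + \<beta> = \<gamma>}"

lemma finite_bounded_exponents:
  fixes b :: "'n::finite \<Rightarrow> nat"
  shows "finite {\<alpha> :: 'n \<Rightarrow>\<^sub>0 nat. \<forall>i. Poly_Mapping.lookup \<alpha> i \<le> b i}"
proof -
  let ?A = "{\<alpha> :: 'n \<Rightarrow>\<^sub>0 nat. \<forall>i. Poly_Mapping.lookup \<alpha> i \<le> b i}"
  have "finite (\<Pi>\<^sub>E i\<in>(UNIV::'n set). {..b i})"
    by (rule finite_PiE) simp_all
  moreover have "Poly_Mapping.lookup ` ?A \<subseteq> (\<Pi>\<^sub>E i\<in>UNIV. {..b i})"
    by (rule image_subsetI) (simp add: PiE_def Pi_def extensional_def)
  ultimately have "finite (Poly_Mapping.lookup ` ?A)"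
    by (rule rev_finite_subset)
  then show ?thesis
    by (rule finite_imageD) (auto intro: inj_onI poly_mapping_eqI)
qed

lemma finite_splits [simp]: "finite (splits \<gamma>)"
proof -
  let ?B = "{\<alpha>. \<forall>i. Poly_Mapping.lookup \<alpha> i \<le> Poly_Mapping.lookup \<gamma> i}"
  have "splits \<gamma> \<subseteq> ?B \<times> ?B" by (auto simp: splits_def lookup_add)
  then show ?thesis
    by (rule finite_subset) (intro finite_cartesian_product finite_bounded_exponents)
qed

instantiation mps :: (finite, zero) zero
begin
lift_definition zero_mps :: "('a, 'b) mps" is "\<lambda>_. 0" .
instance ..
end

instantiation mps :: (finite, comm_ring_1) comm_ring_1
begin

lift_definition one_mps :: "('a, 'b) mps" is "\<lambda>\<alpha>. if \<alpha> = 0 then 1 else 0" .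
lift_definition plus_mps :: "('a, 'b) mps \<Rightarrow> ('a, 'b) mps \<Rightarrow> ('a, 'b) mps" is "\<lambda>f g \<alpha>. f \<alpha> + g \<alpha>" .
lift_definition minus_mps :: "('a, 'b) mps \<Rightarrow> ('a, 'b) mps \<Rightarrow> ('a, 'b) mps" is "\<lambda>f g \<alpha>. f \<alpha> - g \<alpha>" .
lift_definition uminus_mps :: "('a, 'b) mps \<Rightarrow> ('a, 'b) mps" is "\<lambda>f \<alpha>. - f \<alpha>" .
lift_definition times_mps :: "('a, 'b) mps \<Rightarrow> ('a, 'b) mps \<Rightarrow> ('a, 'b) mps"
  is "\<lambda>f g \<gamma>. \<Sum>(\<alpha>, \<beta>)\<in>splits \<gamma>. f \<alpha> * g \<beta>" .

instance
proof
  fix f g h :: "('a, 'b) mps"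
  show "f * g * h = f * (g * h)"
  proof (transfer, rule ext)
    fix f g h :: "('a \<Rightarrow>\<^sub>0 nat) \<Rightarrow> 'b" and \<gamma>
    have "(\<Sum>(\<sigma>, c)\<in>splits \<gamma>. (\<Sum>(a, b)\<in>splits \<sigma>. f a * g b) * h c)
        = (\<Sum>p\<in>splits \<gamma>. \<Sum>q\<in>splits (fst p). f (fst q) * g (snd q) * h (snd p))"
      by (simp only: case_prod_beta' sum_distrib_right)
    also have "\<dots> = (\<Sum>z\<in>(SIGMA p:splits \<gamma>. splits (fst p)).
                  f (fst (snd z)) * g (snd (snd z)) * h (snd (fst z)))"
      by (subst sum.Sigma) (simp_all add: case_prod_beta')
    also have "\<dots> = (\<Sum>z\<in>(SIGMA p:splits \<gamma>. splits (snd p)).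
                  f (fst (fst z)) * (g (fst (snd z)) * h (snd (snd z))))"
      by (rule sum.reindex_bij_witness[where
            i = "\<lambda>z. ((fst (fst z) + fst (snd z), snd (snd z)), (fst (fst z), fst (snd z)))" and
            j = "\<lambda>z. ((fst (snd z), snd (snd z) + snd (fst z)), (snd (snd z), snd (fst z)))"])
        (auto simp: splits_def add.assoc mult.assoc)
    also have "\<dots> = (\<Sum>p\<in>splits \<gamma>. \<Sum>q\<in>splits (snd p). f (fst p) * (g (fst q) * h (snd q)))"
      by (subst sum.Sigma) (simp_all add: case_prod_beta')
    also have "\<dots> = (\<Sum>(a, \<tau>)\<in>splits \<gamma>. f a * (\<Sum>(b, c)\<in>splits \<tau>. g b * h c))"
      by (simp only: case_prod_beta' sum_distrib_left)
    finally show "(\<Sum>(\<sigma>, c)\<in>splits \<gamma>. (\<Sum>(a, b)\<in>splits \<sigma>. f a * g b) * h c)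
        = (\<Sum>(a, \<tau>)\<in>splits \<gamma>. f a * (\<Sum>(b, c)\<in>splits \<tau>. g b * h c))" .
  qed
  show "f * g = g * f"
  proof (transfer, rule ext)
    fix f g :: "('a \<Rightarrow>\<^sub>0 nat) \<Rightarrow> 'b" and \<gamma>
    show "(\<Sum>(\<alpha>, \<beta>)\<in>splits \<gamma>. f \<alpha> * g \<beta>) = (\<Sum>(\<alpha>, \<beta>)\<in>splits \<gamma>. g \<alpha> * f \<beta>)"
      by (rule sum.reindex_bij_witness[where i = prod.swap and j = prod.swap])
        (auto simp: splits_def add.commute mult.commute)
  qed
  show "1 * f = f"
  proof (transfer, rule ext)
    fix f :: "('a \<Rightarrow>\<^sub>0 nat) \<Rightarrow> 'b" and \<gamma>
    have "(\<Sum>(\<alpha>, \<beta>)\<in>splits \<gamma>. (if \<alpha> = 0 then 1 else 0) * f \<beta>)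
        = (\<Sum>(\<alpha>, \<beta>)\<in>{(0 :: 'a \<Rightarrow>\<^sub>0 nat, \<gamma>)}. (if \<alpha> = 0 then 1 else 0) * f \<beta>)"
      using finite_splits[of \<gamma>]
      by (intro sum.mono_neutral_right) (auto simp: splits_def split: if_splits)
    then show "(\<Sum>(\<alpha>, \<beta>)\<in>splits \<gamma>. (if \<alpha> = 0 then 1 else 0) * f \<beta>) = f \<gamma>" by simp
  qed
  show "(f + g) * h = f * h + g * h"
    by transfer (auto simp: fun_eq_iff algebra_simps sum.distrib case_prod_beta)
  show "(0 :: ('a, 'b) mps) \<noteq> 1"
  proof
    assume "(0 :: ('a, 'b) mps) = 1"
    then have "mps_nth (0 :: ('a, 'b) mps) 0 = mps_nth 1 0" by simp
    then show False by (simp add: zero_mps.rep_eq one_mps.rep_eq)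
  qed
qed (rule mps_eqI, simp add: plus_mps.rep_eq minus_mps.rep_eq uminus_mps.rep_eq zero_mps.rep_eq add.assoc add.commute)+

end

definition mps_deriv :: "'n \<Rightarrow> ('n::finite, 'k::comm_ring_1) mps \<Rightarrow> ('n, 'k) mps"
  where "mps_deriv i f =
    Abs_mps (\<lambda>\<alpha>. of_nat (Suc (Poly_Mapping.lookup \<alpha> i)) * mps_nth f (\<alpha> + Poly_Mapping.single i 1))"

lemma mps_nth_deriv:
  "mps_nth (mps_deriv i f) \<alpha> = of_nat (Suc (Poly_Mapping.lookup \<alpha> i)) * mps_nth f (\<alpha> + Poly_Mapping.single i 1)"
  by (simp add: mps_deriv_def Abs_mps_inverse)

lemma mps_deriv_0 [simp]: "mps_deriv i 0 = 0"
  by (rule mps_eqI) (simp add: mps_nth_deriv zero_mps.rep_eq)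

lemma mps_deriv_1 [simp]: "mps_deriv i 1 = 0"
proof (rule mps_eqI)
  fix \<alpha> :: "'a \<Rightarrow>\<^sub>0 nat"
  have "\<alpha> + Poly_Mapping.single i 1 \<noteq> 0"
  proof
    assume "\<alpha> + Poly_Mapping.single i 1 = 0"
    then have "Poly_Mapping.lookup (\<alpha> + Poly_Mapping.single i 1) i = 0" by simp
    then show False by (simp add: lookup_add)
  qed
  then show "mps_nth (mps_deriv i 1) \<alpha> = mps_nth (0 :: ('a, 'b) mps) \<alpha>"
    by (simp add: mps_nth_deriv zero_mps.rep_eq one_mps.rep_eq)
qed

lemma mps_deriv_add: "mps_deriv i (f + g) = mps_deriv i f + mps_deriv i g"
  by (rule mps_eqI) (simp add: mps_nth_deriv plus_mps.rep_eq algebra_simps)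

lemma mps_deriv_commute: "mps_deriv i (mps_deriv j f) = mps_deriv j (mps_deriv i f)"
proof (cases "i = j")
  case False
  then show ?thesis
    by (intro mps_eqI)
      (simp add: mps_nth_deriv lookup_add lookup_single_not_eq add.commute add.left_commute mult.left_commute)
qed simp

lemma sum_splits_shift:
  fixes f g :: "('n::finite \<Rightarrow>\<^sub>0 nat) \<Rightarrow> 'k::comm_ring_1"
  defines "e \<equiv> \<lambda>i. Poly_Mapping.single i (1::nat)"
  shows "(\<Sum>(\<alpha>, \<beta>)\<in>splits (\<gamma> + e i). of_nat (Poly_Mapping.lookup \<alpha> i) * f \<alpha> * g \<beta>)
       = (\<Sum>(\<alpha>, \<beta>)\<in>splits \<gamma>. of_nat (Suc (Poly_Mapping.lookup \<alpha> i)) * f (\<alpha> + e i) * g \<beta>)"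
    (is "sum ?h _ = _")
proof -
  have shift: "\<alpha> - e i + e i = \<alpha>" if "Poly_Mapping.lookup \<alpha> i \<noteq> 0" for \<alpha>
    using that by (auto intro!: poly_mapping_eqI simp: e_def lookup_add lookup_minus lookup_single when_def)
  have "sum ?h (splits (\<gamma> + e i)) = sum ?h {p \<in> splits (\<gamma> + e i). Poly_Mapping.lookup (fst p) i \<noteq> 0}"
    by (rule sum.mono_neutral_right) (auto intro!: gr0I)
  also have "\<dots> = (\<Sum>(\<alpha>, \<beta>)\<in>splits \<gamma>. of_nat (Suc (Poly_Mapping.lookup \<alpha> i)) * f (\<alpha> + e i) * g \<beta>)"
  proof (rule sum.reindex_bij_witness[where
        i = "\<lambda>(\<alpha>, \<beta>). (\<alpha> + e i, \<beta>)" and j = "\<lambda>(\<alpha>, \<beta>). (\<alpha> - e i, \<beta>)"])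
    fix p assume p: "p \<in> {p \<in> splits (\<gamma> + e i). Poly_Mapping.lookup (fst p) i \<noteq> 0}"
    obtain \<alpha> \<beta> where p_eq: "p = (\<alpha>, \<beta>)" by (cases p)
    from p have \<alpha>: "Poly_Mapping.lookup \<alpha> i \<noteq> 0" and eq: "\<alpha> + \<beta> = \<gamma> + e i" by (auto simp: p_eq splits_def)
    show "(case case p of (\<alpha>, \<beta>) \<Rightarrow> (\<alpha> - e i, \<beta>) of (\<alpha>, \<beta>) \<Rightarrow> (\<alpha> + e i, \<beta>)) = p"
      using shift[OF \<alpha>] by (simp add: p_eq)
    have "(\<alpha> - e i + \<beta>) + e i = \<gamma> + e i"
      using shift[OF \<alpha>] eq by (metis add.assoc add.commute)
    then show "(case p of (\<alpha>, \<beta>) \<Rightarrow> (\<alpha> - e i, \<beta>)) \<in> splits \<gamma>"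
      by (simp add: p_eq splits_def)
    have "Suc (Poly_Mapping.lookup (\<alpha> - e i) i) = Poly_Mapping.lookup \<alpha> i"
      using \<alpha> by (simp add: e_def lookup_minus)
    then show "(case case p of (\<alpha>, \<beta>) \<Rightarrow> (\<alpha> - e i, \<beta>) of
          (\<alpha>, \<beta>) \<Rightarrow> of_nat (Suc (Poly_Mapping.lookup \<alpha> i)) * f (\<alpha> + e i) * g \<beta>) = ?h p"
      using shift[OF \<alpha>] by (simp add: p_eq del: of_nat_Suc)
  next
    fix p assume "p \<in> splits \<gamma>"
    then show "(case case p of (\<alpha>, \<beta>) \<Rightarrow> (\<alpha> + e i, \<beta>) of (\<alpha>, \<beta>) \<Rightarrow> (\<alpha> - e i, \<beta>)) = p"
      and "(case p of (\<alpha>, \<beta>) \<Rightarrow> (\<alpha> + e i, \<beta>)) \<in> {p \<in> splits (\<gamma> + e i). Poly_Mapping.lookup (fst p) i \<noteq> 0}"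
      by (auto simp: splits_def lookup_add algebra_simps e_def split: prod.splits)
  qed
  finally show ?thesis .
qed

lemma sum_splits_swap: "(\<Sum>(\<alpha>, \<beta>)\<in>splits \<gamma>. F \<alpha> \<beta>) = (\<Sum>(\<alpha>, \<beta>)\<in>splits \<gamma>. F \<beta> \<alpha>)"
  by (rule sum.reindex_bij_witness[where i = prod.swap and j = prod.swap])
    (auto simp: splits_def add.commute)

lemma mps_deriv_mult: "mps_deriv i (f * g) = mps_deriv i f * g + f * mps_deriv i g"
proof (rule mps_eqI)
  fix \<gamma> :: "'a \<Rightarrow>\<^sub>0 nat"
  let ?e = "Poly_Mapping.single i (1::nat)"
  let ?f = "mps_nth f" and ?g = "mps_nth g"
  have f': "(\<Sum>(\<alpha>, \<beta>)\<in>splits (\<gamma> + ?e). of_nat (Poly_Mapping.lookup \<alpha> i) * ?f \<alpha> * ?g \<beta>)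
      = mps_nth (mps_deriv i f * g) \<gamma>"
    by (simp only: sum_splits_shift times_mps.rep_eq mps_nth_deriv)
  have "(\<Sum>(\<alpha>, \<beta>)\<in>splits (\<gamma> + ?e). of_nat (Poly_Mapping.lookup \<alpha> i) * ?g \<alpha> * ?f \<beta>)
      = mps_nth (mps_deriv i g * f) \<gamma>"
    by (simp only: sum_splits_shift times_mps.rep_eq mps_nth_deriv)
  then have g': "(\<Sum>(\<alpha>, \<beta>)\<in>splits (\<gamma> + ?e). of_nat (Poly_Mapping.lookup \<beta> i) * ?g \<beta> * ?f \<alpha>)
      = mps_nth (f * mps_deriv i g) \<gamma>"
    by (subst sum_splits_swap) (simp add: mult.commute)
  have "mps_nth (mps_deriv i (f * g)) \<gamma> =
      (\<Sum>(\<alpha>, \<beta>)\<in>splits (\<gamma> + ?e). of_nat (Suc (Poly_Mapping.lookup \<gamma> i)) * (?f \<alpha> * ?g \<beta>))"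
    by (simp add: mps_nth_deriv times_mps.rep_eq sum_distrib_left case_prod_beta del: of_nat_Suc)
  also have "\<dots> = (\<Sum>(\<alpha>, \<beta>)\<in>splits (\<gamma> + ?e).
      of_nat (Poly_Mapping.lookup \<alpha> i) * ?f \<alpha> * ?g \<beta> + of_nat (Poly_Mapping.lookup \<beta> i) * ?g \<beta> * ?f \<alpha>)"
  proof (rule sum.cong[OF refl], clarify)
    fix \<alpha> \<beta> assume "(\<alpha>, \<beta>) \<in> splits (\<gamma> + ?e)"
    then have "\<alpha> + \<beta> = \<gamma> + ?e" by (simp add: splits_def)
    then have "Poly_Mapping.lookup (\<alpha> + \<beta>) i = Poly_Mapping.lookup (\<gamma> + ?e) i" by simp
    then have "Suc (Poly_Mapping.lookup \<gamma> i) = Poly_Mapping.lookup \<alpha> i + Poly_Mapping.lookup \<beta> i" by (simp add: lookup_add)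
    then show "of_nat (Suc (Poly_Mapping.lookup \<gamma> i)) * (?f \<alpha> * ?g \<beta>) =
        of_nat (Poly_Mapping.lookup \<alpha> i) * ?f \<alpha> * ?g \<beta> + of_nat (Poly_Mapping.lookup \<beta> i) * ?g \<beta> * ?f \<alpha>"
      by (simp only: of_nat_add) (simp add: algebra_simps)
  qed
  also have "\<dots> = mps_nth (mps_deriv i f * g + f * mps_deriv i g) \<gamma>"
    using f' g' by (simp add: plus_mps.rep_eq sum.distrib case_prod_beta)
  finally show "mps_nth (mps_deriv i (f * g)) \<gamma> = mps_nth (mps_deriv i f * g + f * mps_deriv i g) \<gamma>" .
qed


section \<open>Differential operators with power series coefficients\<close>

text \<open>
  The operator \<open>\<Sum>c\<^sub>\<beta>(x)\<partial>\<^sup>\<beta>\<close> is represented by its normal form, the finitely supported family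
  of its coefficients \<open>c\<^sub>\<beta>\<close>.  In positive characteristic this is the ring
  presented by the commutation relations, which does not act faithfully on functions.
\<close>

typedef (overloaded) ('n::finite, 'k::zero) diffop = "UNIV :: (('n \<Rightarrow>\<^sub>0 nat) \<Rightarrow>\<^sub>0 ('n, 'k) mps) set"
  morphisms normal_form Diffop ..

setup_lifting type_definition_diffop

lemma diffop_eqI: "normal_form P = normal_form Q \<Longrightarrow> P = Q"
  by (simp add: normal_form_inject)

definition op_coeff :: "('n::finite, 'k::zero) diffop \<Rightarrow> ('n \<Rightarrow>\<^sub>0 nat) \<Rightarrow> ('n, 'k) mps"
  where "op_coeff P = Poly_Mapping.lookup (normal_form P)"

text \<open>
  Left multiplication by \<open>\<partial>\<^sub>i\<close> on normal forms, \<open>\<partial>\<^sub>i c \<partial>\<^sup>\<beta> = c \<partial>\<^sub>i\<partial>\<^sup>\<beta> + (\<partial>c/\<partial>x\<^sub>i) \<partial>\<^sup>\<beta>\<close>;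
  the product \<open>*\<close> below is that of the commutative polynomial ring over the power series.
\<close>

definition nf_deriv ::
    "'n \<Rightarrow> (('n::finite \<Rightarrow>\<^sub>0 nat) \<Rightarrow>\<^sub>0 ('n, 'k::comm_ring_1) mps) \<Rightarrow> (('n \<Rightarrow>\<^sub>0 nat) \<Rightarrow>\<^sub>0 ('n, 'k) mps)"
  where "nf_deriv i = Poly_Mapping.map (mps_deriv i)"

definition nf_partial ::
    "'n \<Rightarrow> (('n::finite \<Rightarrow>\<^sub>0 nat) \<Rightarrow>\<^sub>0 ('n, 'k::comm_ring_1) mps) \<Rightarrow> (('n \<Rightarrow>\<^sub>0 nat) \<Rightarrow>\<^sub>0 ('n, 'k) mps)"
  where "nf_partial i Q = Poly_Mapping.single (Poly_Mapping.single i 1) 1 * Q + nf_deriv i Q"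

definition nf_partial_power ::
    "('n \<Rightarrow>\<^sub>0 nat) \<Rightarrow> (('n::finite \<Rightarrow>\<^sub>0 nat) \<Rightarrow>\<^sub>0 ('n, 'k::comm_ring_1) mps) \<Rightarrow> (('n \<Rightarrow>\<^sub>0 nat) \<Rightarrow>\<^sub>0 ('n, 'k) mps)"
  where "nf_partial_power \<beta> = Finite_Set.fold (\<lambda>i F. (nf_partial i ^^ Poly_Mapping.lookup \<beta> i) \<circ> F) id UNIV"

definition nf_mult ::
    "(('n::finite \<Rightarrow>\<^sub>0 nat) \<Rightarrow>\<^sub>0 ('n, 'k::comm_ring_1) mps) \<Rightarrow> (('n \<Rightarrow>\<^sub>0 nat) \<Rightarrow>\<^sub>0 ('n, 'k) mps)
      \<Rightarrow> (('n \<Rightarrow>\<^sub>0 nat) \<Rightarrow>\<^sub>0 ('n, 'k) mps)"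
  where "nf_mult P Q = (\<Sum>\<beta>\<in>Poly_Mapping.keys P.
    Poly_Mapping.single 0 (Poly_Mapping.lookup P \<beta>) * nf_partial_power \<beta> Q)"

lemma lookup_nf_deriv: "Poly_Mapping.lookup (nf_deriv i Q) \<beta> = mps_deriv i (Poly_Mapping.lookup Q \<beta>)"
  by (simp add: nf_deriv_def Poly_Mapping.map.rep_eq when_def)

lemma nf_deriv_0 [simp]: "nf_deriv i 0 = 0"
  by (rule poly_mapping_eqI) (simp add: lookup_nf_deriv)

lemma nf_deriv_add: "nf_deriv i (P + Q) = nf_deriv i P + nf_deriv i Q"
  by (rule poly_mapping_eqI) (simp add: lookup_nf_deriv lookup_add mps_deriv_add)

lemma nf_deriv_single: "nf_deriv i (Poly_Mapping.single \<beta> c) = Poly_Mapping.single \<beta> (mps_deriv i c)"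
  by (rule poly_mapping_eqI) (simp add: lookup_nf_deriv lookup_single when_def)

lemma nf_induct [case_names zero add single]:
  fixes P :: "(('n \<Rightarrow>\<^sub>0 nat) \<Rightarrow>\<^sub>0 'b::comm_ring_1) \<Rightarrow> bool"
  assumes "P 0" "\<And>F G. P F \<Longrightarrow> P G \<Longrightarrow> P (F + G)" "\<And>\<beta> c. P (Poly_Mapping.single \<beta> c)"
  shows "P F"
proof -
  have F: "F = (\<Sum>\<beta>\<in>Poly_Mapping.keys F. Poly_Mapping.single \<beta> (Poly_Mapping.lookup F \<beta>))"
    by (rule poly_mapping_eqI)
      (simp add: lookup_sum lookup_single when_def in_keys_iff)
  have "P (\<Sum>\<beta>\<in>B. Poly_Mapping.single \<beta> (Poly_Mapping.lookup F \<beta>))" if "finite B" for B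
    using that by (induction B) (auto intro: assms)
  then show ?thesis using F by (metis finite_keys)
qed

lemma nf_deriv_mult: "nf_deriv i (P * Q) = nf_deriv i P * Q + P * nf_deriv i Q"
proof (induction P rule: nf_induct)
  case zero
  show ?case by simp
next
  case (add P1 P2)
  then show ?case by (simp add: nf_deriv_add algebra_simps)
next
  case (single \<beta> c)
  show ?case
  proof (induction Q rule: nf_induct)
    case zero
    show ?case by simp
  next
    case (add Q1 Q2)
    then show ?case by (simp add: nf_deriv_add algebra_simps)
  next
    case (single \<gamma> d)
    show ?case by (simp add: nf_deriv_single mult_single mps_deriv_mult single_add)
  qed
qed

lemma nf_partial_add: "nf_partial i (P + Q) = nf_partial i P + nf_partial i Q"
  by (simp add: nf_partial_def nf_deriv_add algebra_simps)

lemma nf_partial_commute: "nf_partial i (nf_partial j Q) = nf_partial j (nf_partial i Q)"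
proof -
  have "nf_deriv i (nf_deriv j Q) = nf_deriv j (nf_deriv i Q)"
    by (rule poly_mapping_eqI) (simp add: lookup_nf_deriv mps_deriv_commute)
  then show ?thesis
    by (simp add: nf_partial_def nf_deriv_add nf_deriv_mult nf_deriv_single algebra_simps)
qed

lemma nf_partial_scale:
  "nf_partial i (Poly_Mapping.single 0 c * Q) =
    Poly_Mapping.single 0 c * nf_partial i Q + Poly_Mapping.single 0 (mps_deriv i c) * Q"
  by (simp add: nf_partial_def nf_deriv_mult nf_deriv_single algebra_simps)

lemma nf_partial_funpow_commute:
  "(nf_partial i ^^ a) \<circ> (nf_partial j ^^ b) = (nf_partial j ^^ b) \<circ> (nf_partial i ^^ a)"
proof -
  have 1: "nf_partial i ((nf_partial j ^^ b) Q) = (nf_partial j ^^ b) (nf_partial i Q)" for Q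
    by (induction b) (simp_all add: nf_partial_commute[of i j])
  show ?thesis
    by (induction a) (auto simp: fun_eq_iff 1)
qed

interpretation nf_partial_fold:
  comp_fun_commute "\<lambda>i F. (nf_partial i ^^ Poly_Mapping.lookup \<beta> i) \<circ> F"
  by standard (simp add: fun_eq_iff, metis comp_apply nf_partial_funpow_commute)

lemma nf_partial_power_0 [simp]:
  fixes Q :: "('n::finite \<Rightarrow>\<^sub>0 nat) \<Rightarrow>\<^sub>0 ('n, 'k::comm_ring_1) mps"
  shows "nf_partial_power 0 Q = Q"
proof -
  have "Finite_Set.fold (\<lambda>i F. (nf_partial i ^^ Poly_Mapping.lookup 0 i) \<circ> F) id B = (id :: _ \<Rightarrow> ('n \<Rightarrow>\<^sub>0 nat) \<Rightarrow>\<^sub>0 ('n, 'k) mps)"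
    if "finite B" for B :: "'n set"
    using that
  proof (induction B)
    case (insert i B)
    show ?case
      by (subst nf_partial_fold.fold_insert[OF insert.hyps], subst insert.IH) simp
  qed simp
  from this[of UNIV] show ?thesis by (simp only: nf_partial_power_def finite id_apply)
qed

lemma nf_partial_power_Suc:
  "nf_partial_power (\<beta> + Poly_Mapping.single i 1) Q = nf_partial i (nf_partial_power \<beta> Q)"
proof -
  let ?\<beta>' = "\<beta> + Poly_Mapping.single i 1"
  let ?fold = "\<lambda>\<beta>. Finite_Set.fold (\<lambda>j F. (nf_partial j ^^ Poly_Mapping.lookup \<beta> j) \<circ> F) id"
  have A: "?fold ?\<beta>' (UNIV - {i}) = ?fold \<beta> (UNIV - {i})"
    by (rule Finite_Set.fold_cong[where S = UNIV, OF nf_partial_fold.comp_fun_commute_on_axioms nf_partial_fold.comp_fun_commute_on_axioms])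
      (auto simp: lookup_add lookup_single_not_eq)
  have B: "?fold \<beta> UNIV = (nf_partial i ^^ Poly_Mapping.lookup \<beta> i) \<circ> ?fold \<beta> (UNIV - {i})" for \<beta>
    by (rule nf_partial_fold.fold_rec) auto
  have C: "(nf_partial i ^^ Poly_Mapping.lookup ?\<beta>' i) = nf_partial i \<circ> (nf_partial i ^^ Poly_Mapping.lookup \<beta> i)"
    by (simp add: lookup_add)
  have "?fold ?\<beta>' UNIV = nf_partial i \<circ> ?fold \<beta> UNIV"
    by (simp only: B A C comp_assoc)
  from fun_cong[OF this, of Q] show ?thesis
    by (simp only: nf_partial_power_def comp_apply)
qed

lemma exponent_induct [case_names zero Suc]:
  fixes P :: "('n::finite \<Rightarrow>\<^sub>0 nat) \<Rightarrow> bool"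
  assumes "P 0" "\<And>\<beta> i. P \<beta> \<Longrightarrow> P (\<beta> + Poly_Mapping.single i 1)"
  shows "P \<beta>"
proof (induction "\<Sum>i\<in>UNIV. Poly_Mapping.lookup \<beta> i" arbitrary: \<beta>)
  case 0
  then have "\<beta> = 0" by (auto intro: poly_mapping_eqI)
  then show ?case using assms(1) by simp
next
  case (Suc n)
  then obtain i where i: "Poly_Mapping.lookup \<beta> i \<noteq> 0"
    by (metis (no_types, lifting) Zero_not_Suc sum.neutral)
  define \<beta>' where "\<beta>' = \<beta> - Poly_Mapping.single i 1"
  have \<beta>: "\<beta> = \<beta>' + Poly_Mapping.single i 1"
    using i by (auto intro!: poly_mapping_eqI simp: \<beta>'_def lookup_add lookup_minus lookup_single when_def)
  have "(\<Sum>j\<in>UNIV. Poly_Mapping.lookup \<beta> j) = (\<Sum>j\<in>UNIV. Poly_Mapping.lookup \<beta>' j) + 1"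
    by (subst \<beta>) (simp add: lookup_add sum.distrib lookup_single when_def)
  then have "P \<beta>'" using Suc by simp
  then show ?case using assms(2) \<beta> by metis
qed

lemma nf_partial_power_add: "nf_partial_power \<beta> (P + Q) = nf_partial_power \<beta> P + nf_partial_power \<beta> Q"
proof (induction \<beta> rule: exponent_induct)
  case zero
  show ?case by simp
next
  case (Suc \<beta> i)
  then show ?case by (simp only: nf_partial_power_Suc nf_partial_add)
qed

lemma nf_mult_superset:
  assumes "finite B" "Poly_Mapping.keys P \<subseteq> B"
  shows "nf_mult P Q = (\<Sum>\<beta>\<in>B. Poly_Mapping.single 0 (Poly_Mapping.lookup P \<beta>) * nf_partial_power \<beta> Q)"
  unfolding nf_mult_def using assms
  by (intro sum.mono_neutral_left) (auto simp: in_keys_iff)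

lemma nf_mult_0_left [simp]: "nf_mult 0 Q = 0"
  by (simp add: nf_mult_def)

lemma nf_mult_add_left: "nf_mult (P1 + P2) Q = nf_mult P1 Q + nf_mult P2 Q"
proof -
  let ?B = "Poly_Mapping.keys P1 \<union> Poly_Mapping.keys P2"
  have "finite ?B" "Poly_Mapping.keys (P1 + P2) \<subseteq> ?B"
    by (auto simp: in_keys_iff lookup_add)
  then show ?thesis
    by (simp add: nf_mult_superset[of ?B] lookup_add single_add distrib_right sum.distrib)
qed

lemma nf_mult_add_right: "nf_mult P (Q1 + Q2) = nf_mult P Q1 + nf_mult P Q2"
  by (simp add: nf_mult_def nf_partial_power_add distrib_left sum.distrib)

lemma nf_mult_single:
  "nf_mult (Poly_Mapping.single \<beta> c) Q = Poly_Mapping.single 0 c * nf_partial_power \<beta> Q"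
  by (subst nf_mult_superset[of "{\<beta>}"]) auto

lemma nf_partial_single:
  "nf_partial i (Poly_Mapping.single \<beta> c) =
    Poly_Mapping.single (\<beta> + Poly_Mapping.single i 1) c + Poly_Mapping.single \<beta> (mps_deriv i c)"
  by (simp add: nf_partial_def nf_deriv_single mult_single add.commute)

lemma nf_partial_0 [simp]: "nf_partial i 0 = 0"
  using nf_partial_add[of i 0 0] by simp

lemma nf_partial_mult: "nf_mult (nf_partial i P) Q = nf_partial i (nf_mult P Q)"
proof (induction P rule: nf_induct)
  case (single \<beta> c)
  show ?case
    by (simp add: nf_partial_single nf_mult_add_left nf_mult_single nf_partial_power_Suc nf_partial_scale
        del: One_nat_def)
qed (simp_all add: nf_partial_add nf_mult_add_left)

lemma nf_partial_power_mult: "nf_mult (nf_partial_power \<beta> P) Q = nf_partial_power \<beta> (nf_mult P Q)"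
proof (induction \<beta> rule: exponent_induct)
  case zero
  show ?case by simp
next
  case (Suc \<beta> i)
  then show ?case by (simp only: nf_partial_power_Suc nf_partial_mult)
qed

lemma nf_scale_mult:
  "nf_mult (Poly_Mapping.single 0 c * P) Q = Poly_Mapping.single 0 c * nf_mult P Q"
proof (induction P rule: nf_induct)
  case (single \<beta> d)
  show ?case
    by (simp add: mult_single nf_mult_single) (simp add: mult.assoc[symmetric] mult_single)
qed (simp_all add: nf_mult_add_left algebra_simps)

lemma nf_mult_assoc: "nf_mult (nf_mult P Q) R = nf_mult P (nf_mult Q R)"
  by (induction P rule: nf_induct)
    (simp_all add: nf_mult_add_left nf_mult_single nf_scale_mult nf_partial_power_mult)

lemma nf_partial_power_one: "nf_partial_power \<beta> 1 = Poly_Mapping.single \<beta> 1"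
proof (induction \<beta> rule: exponent_induct)
  case zero
  show ?case by simp
next
  case (Suc \<beta> i)
  then show ?case by (simp only: nf_partial_power_Suc nf_partial_single mps_deriv_1 single_zero add_0_right)
qed

lemma nf_mult_1_left: "nf_mult 1 Q = Q"
  using nf_mult_single[of 0 1 Q] by simp

lemma nf_mult_1_right: "nf_mult P 1 = P"
  by (induction P rule: nf_induct)
    (simp_all add: nf_mult_add_left nf_mult_single nf_partial_power_one mult_single)

instantiation diffop :: (finite, comm_ring_1) ring_1
begin

lift_definition zero_diffop :: "('a, 'b) diffop" is 0 .
lift_definition one_diffop :: "('a, 'b) diffop" is 1 .
lift_definition plus_diffop :: "('a, 'b) diffop \<Rightarrow> ('a, 'b) diffop \<Rightarrow> ('a, 'b) diffop" is "(+)" .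
lift_definition minus_diffop :: "('a, 'b) diffop \<Rightarrow> ('a, 'b) diffop \<Rightarrow> ('a, 'b) diffop" is "(-)" .
lift_definition uminus_diffop :: "('a, 'b) diffop \<Rightarrow> ('a, 'b) diffop" is uminus .
lift_definition times_diffop :: "('a, 'b) diffop \<Rightarrow> ('a, 'b) diffop \<Rightarrow> ('a, 'b) diffop" is nf_mult .

instance
  by standard
    (transfer; simp add: nf_mult_assoc nf_mult_add_left nf_mult_add_right nf_mult_1_left nf_mult_1_right)+

end

definition op_const :: "('n::finite, 'k::zero) mps \<Rightarrow> ('n, 'k) diffop"
  where "op_const c = Diffop (Poly_Mapping.single 0 c)"

definition op_partial :: "'n \<Rightarrow> ('n::finite, 'k::comm_ring_1) diffop"
  where "op_partial i = Diffop (Poly_Mapping.single (Poly_Mapping.single i 1) 1)"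

lemma op_const_add: "op_const (c + d) = op_const c + op_const d"
  by (simp add: op_const_def diffop_eqI plus_diffop.rep_eq Diffop_inverse single_add)

lemma op_const_1: "op_const 1 = 1"
  by (simp add: op_const_def diffop_eqI one_diffop.rep_eq Diffop_inverse)

lemma op_const_mult: "op_const (c * d) = op_const c * op_const d"
  by (simp add: op_const_def diffop_eqI times_diffop.rep_eq Diffop_inverse nf_mult_single mult_single)

lemma normal_form_const_mult: "normal_form (op_const c * P) = Poly_Mapping.single 0 c * normal_form P"
  by (simp add: op_const_def times_diffop.rep_eq Diffop_inverse nf_mult_single)

lemma normal_form_partial_mult: "normal_form (op_partial i * P) = nf_partial i (normal_form P)"
  using nf_partial_power_Suc[of 0 i "normal_form P"]
  by (simp add: op_partial_def times_diffop.rep_eq Diffop_inverse nf_mult_single)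

lemma op_partial_const:
  "op_partial i * op_const c - op_const c * op_partial i = op_const (mps_deriv i c)"
proof (rule diffop_eqI)
  have "normal_form (op_const c * op_partial i) = Poly_Mapping.single (Poly_Mapping.single i 1) c"
    by (simp add: normal_form_const_mult) (simp add: op_partial_def Diffop_inverse mult_single)
  moreover have "normal_form (op_partial i * op_const c) =
      Poly_Mapping.single (Poly_Mapping.single i 1) c + Poly_Mapping.single 0 (mps_deriv i c)"
    by (simp add: normal_form_partial_mult) (simp add: op_const_def Diffop_inverse nf_partial_single)
  ultimately show "normal_form (op_partial i * op_const c - op_const c * op_partial i) =
      normal_form (op_const (mps_deriv i c))"
    by (simp add: minus_diffop.rep_eq) (simp add: op_const_def Diffop_inverse)
qed

lemma op_partial_commute: "op_partial i * op_partial j = op_partial j * op_partial i"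
proof -
  have "op_partial i * (op_partial j * 1) = op_partial j * (op_partial i * 1)"
    by (rule diffop_eqI) (simp only: normal_form_partial_mult nf_partial_commute)
  then show ?thesis by simp
qed


section \<open>Polynomials and the localization at the origin\<close>

definition mps_of_poly :: "(('n::finite \<Rightarrow>\<^sub>0 nat) \<Rightarrow>\<^sub>0 'k::zero) \<Rightarrow> ('n, 'k) mps"
  where "mps_of_poly p = Abs_mps (Poly_Mapping.lookup p)"

definition polys :: "('n::finite, 'k::zero) mps set"
  where "polys = range mps_of_poly"

text \<open>
  The localization of the polynomial ring at the origin, as a subring of the power series:
  a polynomial with nonzero constant term is a unit there, so \<open>q * f = p\<close> says \<open>f = p/q\<close>.
\<close>

definition local_series :: "('n::finite, 'k::field) mps set"
  where "local_series = {f. \<exists>p\<in>polys. \<exists>q\<in>polys. mps_nth q 0 \<noteq> 0 \<and> q * f = p}"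

text \<open>
  For a coefficient ring closed under the derivations, this is the ring generated by that
  ring and the \<open>\<partial>\<^sub>i\<close>.
\<close>

definition diffops_over :: "('n::finite, 'k::zero) mps set \<Rightarrow> ('n, 'k) diffop set"
  where "diffops_over C = {P. \<forall>\<beta>. op_coeff P \<beta> \<in> C}"

abbreviation poly_diffops :: "('n::finite, 'k::zero) diffop set"
  where "poly_diffops \<equiv> diffops_over polys"

abbreviation local_diffops :: "('n::finite, 'k::field) diffop set"
  where "local_diffops \<equiv> diffops_over local_series"

lemma mps_nth_of_poly: "mps_nth (mps_of_poly p) = Poly_Mapping.lookup p"
  by (simp add: mps_of_poly_def Abs_mps_inverse)

lemma mps_of_poly_inject: "mps_of_poly p = mps_of_poly q \<longleftrightarrow> p = q"
  by (metis mps_nth_of_poly poly_mapping_eq_iff)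

lemma mps_of_poly_0: "mps_of_poly 0 = 0"
  by (rule mps_eqI) (simp add: mps_nth_of_poly zero_mps.rep_eq)

lemma mps_of_poly_1: "mps_of_poly 1 = 1"
  by (rule mps_eqI) (simp add: mps_nth_of_poly one_mps.rep_eq lookup_one when_def)

lemma mps_of_poly_add: "mps_of_poly (p + q) = mps_of_poly p + mps_of_poly q"
  by (rule mps_eqI) (simp add: mps_nth_of_poly plus_mps.rep_eq lookup_add)

lemma mps_of_poly_uminus: "mps_of_poly (- p) = - mps_of_poly p"
  by (rule mps_eqI) (simp add: mps_nth_of_poly uminus_mps.rep_eq)

lemma mps_of_poly_mult: "mps_of_poly (p * q) = mps_of_poly p * mps_of_poly q"
proof (induction p rule: nf_induct)
  case (single \<alpha> c)
  show ?case
  proof (induction q rule: nf_induct)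
    case (single \<beta> d)
    show ?case
    proof (rule mps_eqI)
      fix \<gamma>
      have "mps_nth (mps_of_poly (Poly_Mapping.single \<alpha> c) * mps_of_poly (Poly_Mapping.single \<beta> d)) \<gamma>
          = (\<Sum>(a, b)\<in>splits \<gamma> \<inter> {(\<alpha>, \<beta>)}. c * d)"
        unfolding times_mps.rep_eq mps_nth_of_poly
        by (rule sum.mono_neutral_cong_right) (auto simp: lookup_single when_def split: if_splits)
      also have "\<dots> = mps_nth (mps_of_poly (Poly_Mapping.single \<alpha> c * Poly_Mapping.single \<beta> d)) \<gamma>"
        by (cases "\<alpha> + \<beta> = \<gamma>") (auto simp: mult_single mps_nth_of_poly lookup_single splits_def)
      finally show "mps_nth (mps_of_poly (Poly_Mapping.single \<alpha> c * Poly_Mapping.single \<beta> d)) \<gamma> =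
          mps_nth (mps_of_poly (Poly_Mapping.single \<alpha> c) * mps_of_poly (Poly_Mapping.single \<beta> d)) \<gamma>"
        by simp
    qed
  qed (simp_all add: mps_of_poly_0 mps_of_poly_add algebra_simps)
qed (simp_all add: mps_of_poly_0 mps_of_poly_add algebra_simps)


section \<open>Left ideals\<close>

text \<open>
  Left ideals of a subring \<open>R\<close> of the ambient ring; for commutative \<open>R\<close> these are its ideals.
  The left ideal of \<open>R\<close> generated by a set \<open>S \<subseteq> R\<close> is \<open>left_ideal R hull S\<close>.
\<close>

definition left_ideal :: "'a::ring_1 set \<Rightarrow> 'a set \<Rightarrow> bool"
  where "left_ideal R I \<longleftrightarrow> I \<subseteq> R \<and> 0 \<in> I \<and> (\<forall>a\<in>I. \<forall>b\<in>I. a + b \<in> I) \<and> (\<forall>r\<in>R. \<forall>a\<in>I. r * a \<in> I)"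


section \<open>Initial forms and the open Groebner fan\<close>

definition weight :: "real ^ 'n \<Rightarrow> ('n::finite \<Rightarrow>\<^sub>0 nat) \<Rightarrow> real"
  where "weight u \<alpha> = (\<Sum>i\<in>UNIV. u $ i * real (Poly_Mapping.lookup \<alpha> i))"

text \<open>
  A possibly infinite family \<open>c\<close> of coefficients stands for \<open>\<Sum>c\<^sub>m m\<close>.  The maximum need not
  exist in general, and there may be infinitely many terms of maximal weight; neither
  happens for nonzero elements and the weights considered below, see
  \<open>ord_wrt_attained\<close>, \<open>finite_support_in_u\<close>, \<open>finite_support_in_w\<close>.  The initial form of
  an element is then an element of the polynomial ring identified with the
  associated graded ring.
\<close>

definition ord_wrt :: "('m \<Rightarrow> real) \<Rightarrow> ('m \<Rightarrow> 'k::zero) \<Rightarrow> real"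
  where "ord_wrt W c = (GREATEST r. \<exists>m. c m \<noteq> 0 \<and> r = W m)"

definition initial_part :: "('m \<Rightarrow> real) \<Rightarrow> ('m \<Rightarrow> 'k::zero) \<Rightarrow> ('m \<Rightarrow>\<^sub>0 'k)"
  where "initial_part W c = Abs_poly_mapping (\<lambda>m. if W m = ord_wrt W c then c m else 0)"

definition in_u :: "real ^ 'n \<Rightarrow> ('n::finite, 'k::zero) mps \<Rightarrow> (('n \<Rightarrow>\<^sub>0 nat) \<Rightarrow>\<^sub>0 'k)"
  where "in_u u f = initial_part (weight u) (mps_nth f)"

text \<open>The exponent \<open>(\<alpha>, \<beta>)\<close> stands for the monomial \<open>x\<^sup>\<alpha>\<xi>\<^sup>\<beta>\<close>.\<close>

definition in_w ::
    "(real ^ 'n) \<times> (real ^ 'n) \<Rightarrow> ('n::finite, 'k::zero) diffop \<Rightarrow> (('n \<Rightarrow>\<^sub>0 nat) \<times> ('n \<Rightarrow>\<^sub>0 nat)) \<Rightarrow>\<^sub>0 'k"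
  where "in_w w P = initial_part
    (\<lambda>(\<alpha>, \<beta>). weight (fst w) \<alpha> + weight (snd w) \<beta>)
    (\<lambda>(\<alpha>, \<beta>). mps_nth (op_coeff P \<beta>) \<alpha>)"

definition U_loc :: "(real ^ 'n) set"
  where "U_loc = {u. \<forall>i. u $ i < 0}"

definition W_loc :: "((real ^ 'n) \<times> (real ^ 'n)) set"
  where "W_loc = {(u, v). \<forall>i. u $ i < 0 \<and> u $ i + v $ i > 0}"

definition initial_ideal :: "('a \<Rightarrow> 'g::ring_1) \<Rightarrow> 'a set \<Rightarrow> 'g set"
  where "initial_ideal ini I = left_ideal UNIV hull (ini ` I)"

text \<open>
  On the sets of weights considered here all graded rings coincide (with the
  polynomial ring in \<open>x\<close>, respectively in \<open>x, \<xi>\<close>), so that weights are compared by their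
  initial ideals alone.
\<close>

definition open_fan :: "('w \<Rightarrow> 'a \<Rightarrow> 'g::ring_1) \<Rightarrow> 'a set \<Rightarrow> 'w set \<Rightarrow> 'w set set"
  where "open_fan ini I U =
    U // {(w, w'). w \<in> U \<and> w' \<in> U \<and> initial_ideal (ini w) I = initial_ideal (ini w') I}"

lemma ord_wrt_attained:
  assumes fin: "\<And>r. finite {m. c m \<noteq> 0 \<and> r \<le> W m}" and "c m0 \<noteq> 0"
  shows "\<exists>m. c m \<noteq> 0 \<and> W m = ord_wrt W c"
    and "\<And>m. c m \<noteq> 0 \<Longrightarrow> W m \<le> ord_wrt W c"
proof -
  let ?A = "{m. c m \<noteq> 0 \<and> W m0 \<le> W m}"
  have A: "finite (W ` ?A)" "W ` ?A \<noteq> {}" using fin assms(2) by auto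
  obtain m1 where m1: "m1 \<in> ?A" "Max (W ` ?A) = W m1"
    using Max_in[OF A] by (rule imageE)
  have max: "W m \<le> W m1" if "c m \<noteq> 0" for m
  proof (cases "W m0 \<le> W m")
    case True
    then have "W m \<in> W ` ?A" using that by simp
    then show ?thesis using Max_ge[OF A(1)] m1(2) by simp
  next
    case False
    then show ?thesis using m1(1) by auto
  qed
  have "ord_wrt W c = W m1"
    unfolding ord_wrt_def using m1(1) max by (intro Greatest_equality) auto
  then show "\<exists>m. c m \<noteq> 0 \<and> W m = ord_wrt W c" "c m \<noteq> 0 \<Longrightarrow> W m \<le> ord_wrt W c" for m
    using m1(1) max[of m] by auto
qed

lemma lookup_initial_part:
  assumes "\<And>r. finite {m. c m \<noteq> 0 \<and> r \<le> W m}"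
  shows "Poly_Mapping.lookup (initial_part W c) m = (if W m = ord_wrt W c then c m else 0)"
proof -
  have "finite {m. (if W m = ord_wrt W c then c m else 0) \<noteq> 0}"
    by (rule finite_subset[OF _ assms[of "ord_wrt W c"]]) auto
  then show ?thesis by (simp add: initial_part_def)
qed

lemma finite_weight_ge:
  assumes "u \<in> U_loc"
  shows "finite {\<alpha>. r \<le> weight u \<alpha>}"
proof (rule finite_subset[OF _ finite_bounded_exponents])
  show "{\<alpha>. r \<le> weight u \<alpha>} \<subseteq> {\<alpha>. \<forall>i. Poly_Mapping.lookup \<alpha> i \<le> nat \<lceil>r / u $ i\<rceil>}"
  proof (clarify)
    fix \<alpha> i assume r: "r \<le> weight u \<alpha>"
    have "weight u \<alpha> = u $ i * real (Poly_Mapping.lookup \<alpha> i) + (\<Sum>j\<in>UNIV - {i}. u $ j * real (Poly_Mapping.lookup \<alpha> j))"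
      by (simp add: weight_def sum.remove)
    also have "\<dots> \<le> u $ i * real (Poly_Mapping.lookup \<alpha> i)"
      using assms by (auto simp: U_loc_def less_imp_le mult_nonpos_nonneg intro!: sum_nonpos)
    finally have "real (Poly_Mapping.lookup \<alpha> i) \<le> r / u $ i"
      using assms r by (simp add: U_loc_def neg_le_divide_eq mult.commute)
    then show "Poly_Mapping.lookup \<alpha> i \<le> nat \<lceil>r / u $ i\<rceil>" by linarith
  qed
qed

lemma finite_support_in_u:
  "u \<in> U_loc \<Longrightarrow> finite {\<alpha>. mps_nth f \<alpha> \<noteq> 0 \<and> r \<le> weight u \<alpha>}"
  by (rule finite_subset[OF _ finite_weight_ge]) auto

lemma finite_support_in_w:
  fixes P :: "('n::finite, 'k::zero) diffop"
  assumes "w \<in> W_loc"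
  shows "finite {m. (case m of (\<alpha>, \<beta>) \<Rightarrow> mps_nth (op_coeff P \<beta>) \<alpha>) \<noteq> 0 \<and>
    r \<le> (case m of (\<alpha>, \<beta>) \<Rightarrow> weight (fst w) \<alpha> + weight (snd w) \<beta>)}"
proof (rule finite_subset)
  let ?S = "\<lambda>\<beta>. {\<alpha>. r - weight (snd w) \<beta> \<le> weight (fst w) \<alpha>}"
  show "{m. (case m of (\<alpha>, \<beta>) \<Rightarrow> mps_nth (op_coeff P \<beta>) \<alpha>) \<noteq> 0 \<and>
      r \<le> (case m of (\<alpha>, \<beta>) \<Rightarrow> weight (fst w) \<alpha> + weight (snd w) \<beta>)}
    \<subseteq> (\<Union>\<beta>\<in>Poly_Mapping.keys (normal_form P). ?S \<beta> \<times> {\<beta>})"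
    by (auto simp: op_coeff_def in_keys_iff zero_mps.rep_eq)
  have "fst w \<in> U_loc" using assms by (auto simp: W_loc_def U_loc_def)
  then show "finite (\<Union>\<beta>\<in>Poly_Mapping.keys (normal_form P). ?S \<beta> \<times> {\<beta>})"
    by (auto intro: finite_weight_ge)
qed

lemma lookup_in_u:
  "u \<in> U_loc \<Longrightarrow> Poly_Mapping.lookup (in_u u f) \<alpha> =
    (if weight u \<alpha> = ord_wrt (weight u) (mps_nth f) then mps_nth f \<alpha> else 0)"
  by (simp add: in_u_def lookup_initial_part finite_support_in_u)

lemma equiv_initial_ideal:
  "equiv U {(w, w'). w \<in> U \<and> w' \<in> U \<and> initial_ideal (ini w) I = initial_ideal (ini w') I}"
  by (rule equivI) (auto simp: refl_on_def sym_def trans_def)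


section \<open>The coefficient sets are rings\<close>

lemma polysI [intro]: "mps_of_poly p \<in> polys"
  by (simp add: polys_def)

lemma polys_0: "0 \<in> polys" and polys_1: "1 \<in> polys"
  by (metis mps_of_poly_0 polysI, metis mps_of_poly_1 polysI)

lemma polys_add: "f \<in> polys \<Longrightarrow> g \<in> polys \<Longrightarrow> f + g \<in> polys"
  by (auto simp: polys_def mps_of_poly_add[symmetric])

lemma polys_uminus: "f \<in> polys \<Longrightarrow> - f \<in> polys"
  by (auto simp: polys_def mps_of_poly_uminus[symmetric])

lemma polys_diff: "f \<in> polys \<Longrightarrow> g \<in> polys \<Longrightarrow> f - g \<in> polys"
  using polys_add[of f "- g"] polys_uminus[of g] by simp

lemma polys_mult: "f \<in> polys \<Longrightarrow> g \<in> polys \<Longrightarrow> f * g \<in> polys"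
  by (auto simp: polys_def mps_of_poly_mult[symmetric])

lemma polys_iff: "f \<in> polys \<longleftrightarrow> finite {\<alpha>. mps_nth f \<alpha> \<noteq> 0}"
proof
  assume "finite {\<alpha>. mps_nth f \<alpha> \<noteq> 0}"
  then have "f = mps_of_poly (Abs_poly_mapping (mps_nth f))"
    by (intro mps_eqI) (simp add: mps_nth_of_poly)
  then show "f \<in> polys" by (metis polysI)
qed (auto simp: polys_def mps_nth_of_poly)

lemma polys_deriv: "f \<in> polys \<Longrightarrow> mps_deriv i f \<in> polys"
proof -
  assume "f \<in> polys"
  then have "finite ((\<lambda>\<alpha>. \<alpha> + Poly_Mapping.single i 1) -` {\<alpha>. mps_nth f \<alpha> \<noteq> 0})"
    by (intro finite_vimageI) (auto simp: polys_iff inj_on_def)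
  then have "finite {\<alpha>. mps_nth (mps_deriv i f) \<alpha> \<noteq> 0}"
    by (rule rev_finite_subset) (auto simp: mps_nth_deriv)
  then show ?thesis by (simp add: polys_iff)
qed

lemma mps_nth_mult_0:
  fixes f g :: "('n::finite, 'k::comm_ring_1) mps"
  shows "mps_nth (f * g) 0 = mps_nth f 0 * mps_nth g 0"
proof -
  have "splits (0 :: 'n \<Rightarrow>\<^sub>0 nat) = {(0, 0)}"
    by (auto simp: splits_def poly_mapping_eq_iff fun_eq_iff lookup_add)
  then show ?thesis by (simp add: times_mps.rep_eq)
qed

lemma local_seriesI:
  "q \<in> polys \<Longrightarrow> mps_nth q 0 \<noteq> 0 \<Longrightarrow> q * f \<in> polys \<Longrightarrow> f \<in> local_series"
  by (auto simp: local_series_def)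

lemma polys_subset_local: "polys \<subseteq> local_series"
  by (rule subsetI, rule local_seriesI[OF polys_1]) (simp_all add: one_mps.rep_eq)

lemma local_add: "f \<in> local_series \<Longrightarrow> g \<in> local_series \<Longrightarrow> f + g \<in> local_series"
proof -
  assume "f \<in> local_series" "g \<in> local_series"
  then obtain q r where qr: "q \<in> polys" "r \<in> polys" "mps_nth q 0 \<noteq> 0" "mps_nth r 0 \<noteq> 0"
    "q * f \<in> polys" "r * g \<in> polys"
    by (auto simp: local_series_def)
  have "q * r * (f + g) = r * (q * f) + q * (r * g)" by (simp add: algebra_simps)
  then show ?thesis
    using qr by (intro local_seriesI[of "q * r"]) (simp_all add: mps_nth_mult_0 polys_add polys_mult)
qed

lemma local_mult: "f \<in> local_series \<Longrightarrow> g \<in> local_series \<Longrightarrow> f * g \<in> local_series"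
proof -
  assume "f \<in> local_series" "g \<in> local_series"
  then obtain q r where qr: "q \<in> polys" "r \<in> polys" "mps_nth q 0 \<noteq> 0" "mps_nth r 0 \<noteq> 0"
    "q * f \<in> polys" "r * g \<in> polys"
    by (auto simp: local_series_def)
  have "q * r * (f * g) = (q * f) * (r * g)" by (simp add: algebra_simps)
  then have "q * r * (f * g) \<in> polys" using qr polys_mult by metis
  then show ?thesis
    using qr by (intro local_seriesI[of "q * r"]) (simp_all add: mps_nth_mult_0 polys_mult)
qed

lemma local_deriv: "f \<in> local_series \<Longrightarrow> mps_deriv i f \<in> local_series"
proof -
  assume "f \<in> local_series"
  then obtain q where q: "q \<in> polys" "mps_nth q 0 \<noteq> 0" "q * f \<in> polys"
    by (auto simp: local_series_def)
  have "q * q * mps_deriv i f = q * mps_deriv i (q * f) - mps_deriv i q * (q * f)"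
    by (simp add: mps_deriv_mult algebra_simps)
  then show ?thesis
    using q by (intro local_seriesI[of "q * q"]) (simp_all add: mps_nth_mult_0 polys_mult polys_deriv polys_diff)
qed

lemma diffops_over_mult:
  fixes C :: "('n::finite, 'k::comm_ring_1) mps set"
  assumes C: "0 \<in> C" "\<And>f g. f \<in> C \<Longrightarrow> g \<in> C \<Longrightarrow> f + g \<in> C" "\<And>f g. f \<in> C \<Longrightarrow> g \<in> C \<Longrightarrow> f * g \<in> C"
    "\<And>f i. f \<in> C \<Longrightarrow> mps_deriv i f \<in> C"
    and PQ: "P \<in> diffops_over C" "Q \<in> diffops_over C"
  shows "P * Q \<in> diffops_over C"
proof -
  have sums: "sum F A \<in> C" if "\<And>a. a \<in> A \<Longrightarrow> F a \<in> C" for F and A :: "('n \<Rightarrow>\<^sub>0 nat) set"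
    using that by (induction A rule: infinite_finite_induct) (auto intro: C)
  let ?N = "{F :: ('n \<Rightarrow>\<^sub>0 nat) \<Rightarrow>\<^sub>0 ('n, 'k) mps. \<forall>\<beta>. Poly_Mapping.lookup F \<beta> \<in> C}"
  have shift: "Poly_Mapping.single (Poly_Mapping.single i 1) 1 * F \<in> ?N" if "F \<in> ?N" for F i
  proof -
    have eq: "Poly_Mapping.single (Poly_Mapping.single i 1) 1 * F =
        (\<Sum>\<beta>\<in>Poly_Mapping.keys F. Poly_Mapping.single (Poly_Mapping.single i 1 + \<beta>) (Poly_Mapping.lookup F \<beta>))"
    proof -
      have "F = (\<Sum>\<beta>\<in>Poly_Mapping.keys F. Poly_Mapping.single \<beta> (Poly_Mapping.lookup F \<beta>))"
        by (rule poly_mapping_eqI) (simp add: lookup_sum lookup_single when_def in_keys_iff)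
      then have "Poly_Mapping.single (Poly_Mapping.single i 1) 1 * F =
          Poly_Mapping.single (Poly_Mapping.single i 1) 1 *
          (\<Sum>\<beta>\<in>Poly_Mapping.keys F. Poly_Mapping.single \<beta> (Poly_Mapping.lookup F \<beta>))" by simp
      then show ?thesis by (simp only: sum_distrib_left mult_single mult_1)
    qed
    show ?thesis
      unfolding eq using that C(1)
      by (auto simp: lookup_sum lookup_single when_def intro!: sums)
  qed
  have part: "nf_partial i F \<in> ?N" if "F \<in> ?N" for F i
    using shift[OF that, of i] that C by (auto simp: nf_partial_def lookup_add lookup_nf_deriv)
  have pow: "nf_partial_power \<beta> F \<in> ?N" if "F \<in> ?N" for F \<beta>
  proof (induction \<beta> rule: exponent_induct)
    case (Suc \<beta> i)
    then show ?case unfolding nf_partial_power_Suc by (rule part)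
  qed (use that in simp)
  have scale: "Poly_Mapping.lookup (Poly_Mapping.single 0 c * F) \<beta> = c * Poly_Mapping.lookup F \<beta>" 
    for c :: "('n, 'k) mps" and F and \<beta> :: "'n \<Rightarrow>\<^sub>0 nat"
    by (simp add: mult_map_scale_conv_mult[symmetric] Poly_Mapping.map.rep_eq when_def)
  have "Poly_Mapping.lookup (nf_mult (normal_form P) (normal_form Q)) \<beta> \<in> C" for \<beta>
    unfolding nf_mult_def lookup_sum scale
    using pow[of "normal_form Q"] PQ C
    by (auto intro!: sums simp: diffops_over_def op_coeff_def)
  then show ?thesis
    by (simp add: diffops_over_def op_coeff_def times_diffop.rep_eq)
qed

lemma left_ideal_rings:
  "left_ideal polys (polys :: ('n::finite, 'k::field) mps set)"
  "left_ideal local_series (local_series :: ('n, 'k) mps set)"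
  "left_ideal (diffops_over polys) (diffops_over polys :: ('n, 'k) diffop set)"
  "left_ideal (diffops_over local_series) (diffops_over local_series :: ('n, 'k) diffop set)"
  using polys_subset_local polys_0
  by (auto simp: left_ideal_def polys_add polys_mult local_add local_mult
      intro!: diffops_over_mult polys_0 polys_deriv local_deriv)
    (auto simp: diffops_over_def op_coeff_def zero_diffop.rep_eq plus_diffop.rep_eq lookup_add
      polys_add local_add polys_mult local_mult)

end

theory Submission
  imports Defs
begin

text \<open>
  Localizing an ideal creates no new initial forms, so the two fans agree because they already
  compare the same ideals weight by weight.  Two facts carry this.

  Clearing denominators: every element \<open>P\<close> of the extended ideal has a multiple \<open>q P\<close> in the
  original one, where \<open>q\<close> is a polynomial with constant term \<open>1\<close>.  For this, the operators
  with such a multiple form a left ideal of \<open>local_diffops\<close> containing the original one.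
  Closure under \<open>\<partial>\<^sub>i\<close> is an Ore condition: \<open>q\<^sup>2 \<partial>\<^sub>i = (q \<partial>\<^sub>i - \<partial>q/\<partial>x\<^sub>i) q\<close>, so the square of a
  denominator for \<open>P\<close> is one for \<open>\<partial>\<^sub>i P\<close>; see \<open>local_hull_clear_denominator\<close> and
  \<open>local_diffops_hull_clear_denominator\<close>.

  Units are invisible: since the variables \<open>x\<^sub>i\<close> have negative weight, the nonconstant terms of
  \<open>q\<close> strictly lower the weight, so \<open>P\<close> and \<open>q P\<close> have the same initial form;
  see \<open>in_u_mult_unit\<close> and \<open>in_w_mult_unit\<close>.
\<close>

section \<open>Initial forms and multiplication by units\<close>

lemma weight_add: "weight u (\<alpha> + \<beta>) = weight u \<alpha> + weight u \<beta>"
  by (simp add: weight_def lookup_add algebra_simps sum.distrib)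

lemma weight_neg:
  assumes "u \<in> U_loc" and "\<alpha> \<noteq> 0"
  shows "weight u \<alpha> < 0"
proof -
  obtain i where "Poly_Mapping.lookup \<alpha> i \<noteq> 0"
    using assms(2) by (metis poly_mapping_eqI lookup_zero)
  then show ?thesis
    using assms(1) unfolding weight_def U_loc_def
    by (intro sum_strict_mono_ex1[of UNIV _ "\<lambda>_. 0", simplified])
      (auto simp: mult_le_0_iff mult_less_0_iff less_imp_le intro!: exI[of _ i])
qed

text \<open>
  The coefficient of \<open>q f\<close> at \<open>\<gamma>\<close> involves, besides \<open>f\<^sub>\<gamma>\<close>, only coefficients of \<open>f\<close> at proper
  divisors of \<open>x\<^sup>\<gamma>\<close>, which have strictly larger weight.
\<close>

lemma mps_nth_mult_unit:
  fixes f q :: "('n::finite, 'k::comm_ring_1) mps"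
  assumes u: "u \<in> U_loc" and q: "mps_nth q 0 = 1"
    and f: "\<And>\<beta>. weight u \<gamma> < weight u \<beta> \<Longrightarrow> mps_nth f \<beta> = 0"
  shows "mps_nth (q * f) \<gamma> = mps_nth f \<gamma>"
proof -
  have "mps_nth (q * f) \<gamma> = (\<Sum>(\<alpha>, \<beta>)\<in>{(0, \<gamma>)}. mps_nth q \<alpha> * mps_nth f \<beta>)"
    unfolding times_mps.rep_eq
  proof (rule sum.mono_neutral_right)
    show "\<forall>p\<in>splits \<gamma> - {(0, \<gamma>)}. (case p of (\<alpha>, \<beta>) \<Rightarrow> mps_nth q \<alpha> * mps_nth f \<beta>) = 0"
    proof (rule ballI)
      fix p assume p: "p \<in> splits \<gamma> - {(0, \<gamma>)}"
      obtain \<alpha> \<beta> where p_eq: "p = (\<alpha>, \<beta>)" by (cases p)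
      have \<gamma>: "\<gamma> = \<alpha> + \<beta>" and "\<alpha> \<noteq> 0" using p by (auto simp: p_eq splits_def)
      then have "weight u \<gamma> < weight u \<beta>" using weight_neg[OF u] by (simp add: weight_add)
      then show "(case p of (\<alpha>, \<beta>) \<Rightarrow> mps_nth q \<alpha> * mps_nth f \<beta>) = 0" by (simp add: p_eq f)
    qed
  qed (use finite_splits[of \<gamma>] in \<open>simp_all add: splits_def\<close>)
  then show ?thesis by (simp add: q)
qed

lemma initial_part_eqI:
  assumes fin: "\<And>r. finite {m. c m \<noteq> 0 \<and> r \<le> W m}" and "c m0 \<noteq> 0"
    and eq: "\<And>m. ord_wrt W c \<le> W m \<Longrightarrow> d m = c m"
  shows "initial_part W d = initial_part W c"
proof -
  note max = ord_wrt_attained[of c W, OF fin assms(2)]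
  obtain m1 where m1: "c m1 \<noteq> 0" "W m1 = ord_wrt W c" using max(1) by auto
  have ord: "ord_wrt W d = ord_wrt W c"
    unfolding ord_wrt_def[of W d]
  proof (rule Greatest_equality)
    show "\<exists>m. d m \<noteq> 0 \<and> ord_wrt W c = W m" using m1 eq[of m1] by (intro exI[of _ m1]) simp
  next
    fix r assume "\<exists>m. d m \<noteq> 0 \<and> r = W m"
    then obtain m where m: "d m \<noteq> 0" "r = W m" by auto
    show "r \<le> ord_wrt W c"
    proof (rule ccontr)
      assume "\<not> r \<le> ord_wrt W c"
      then have "c m \<noteq> 0" using m eq[of m] by simp
      then show False using max(2) m(2) \<open>\<not> r \<le> ord_wrt W c\<close> by blast
    qed
  qed
  have "(\<lambda>m. if W m = ord_wrt W d then d m else 0) = (\<lambda>m. if W m = ord_wrt W c then c m else 0)"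
    using eq by (auto simp: ord)
  then show ?thesis by (simp add: initial_part_def)
qed

lemma in_u_mult_unit:
  fixes f q :: "('n::finite, 'k::comm_ring_1) mps"
  assumes u: "u \<in> U_loc" and q: "mps_nth q 0 = 1"
  shows "in_u u (q * f) = in_u u f"
proof (cases "f = 0")
  case False
  then obtain \<alpha>0 where \<alpha>0: "mps_nth f \<alpha>0 \<noteq> 0" by (metis mps_eqI zero_mps.rep_eq)
  note fin = finite_support_in_u[OF u, of f]
  have "mps_nth f \<beta> = 0" if "ord_wrt (weight u) (mps_nth f) < weight u \<beta>" for \<beta>
    using ord_wrt_attained(2)[of "mps_nth f" "weight u", OF fin \<alpha>0] that by fastforce
  then show ?thesis
    unfolding in_u_def
    by (intro initial_part_eqI[where ?m0.0 = \<alpha>0] fin \<alpha>0 mps_nth_mult_unit[OF u q]) auto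
qed simp

lemma op_coeff_const_mult: "op_coeff (op_const c * P) \<beta> = c * op_coeff P \<beta>"
  by (simp add: op_coeff_def normal_form_const_mult mult_map_scale_conv_mult[symmetric]
      Poly_Mapping.map.rep_eq when_def)

lemma in_w_mult_unit:
  fixes P :: "('n::finite, 'k::comm_ring_1) diffop"
  assumes w: "w \<in> W_loc" and q: "mps_nth q 0 = 1"
  shows "in_w w (op_const q * P) = in_w w P"
proof (cases "P = 0")
  case False
  let ?W = "\<lambda>(\<alpha>, \<beta>). weight (fst w) \<alpha> + weight (snd w) \<beta>"
  let ?c = "\<lambda>(\<alpha>, \<beta>). mps_nth (op_coeff P \<beta>) \<alpha>"
  have u: "fst w \<in> U_loc" using w by (auto simp: W_loc_def U_loc_def)
  have "normal_form P \<noteq> 0" using False diffop_eqI[of P 0] by (auto simp: zero_diffop.rep_eq)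
  then obtain \<beta>0 where "op_coeff P \<beta>0 \<noteq> 0"
    by (metis op_coeff_def poly_mapping_eqI lookup_zero)
  then obtain \<alpha>0 where "mps_nth (op_coeff P \<beta>0) \<alpha>0 \<noteq> 0" by (metis mps_eqI zero_mps.rep_eq)
  then have m0: "?c (\<alpha>0, \<beta>0) \<noteq> 0" by simp
  note fin = finite_support_in_w[OF w, of P]
  have high: "mps_nth (op_coeff P \<beta>) \<alpha> = 0"
    if "ord_wrt ?W ?c < weight (fst w) \<alpha> + weight (snd w) \<beta>" for \<alpha> \<beta>
    using ord_wrt_attained(2)[of ?c ?W, OF fin m0, of "(\<alpha>, \<beta>)"] that by fastforce
  show ?thesis
    unfolding in_w_def
  proof (rule initial_part_eqI[of ?c ?W, OF fin m0])
    fix m assume m: "ord_wrt ?W ?c \<le> ?W m"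
    obtain \<alpha> \<beta> where "m = (\<alpha>, \<beta>)" by (cases m)
    then show "(case m of (\<alpha>, \<beta>) \<Rightarrow> mps_nth (op_coeff (op_const q * P) \<beta>) \<alpha>) = ?c m"
      using m by (auto simp: op_coeff_const_mult intro!: mps_nth_mult_unit[OF u q] high)
  qed
qed simp

section \<open>Clearing denominators\<close>

text \<open>
  Normalizing the constant term of the denominators to \<open>1\<close> makes initial forms literally
  invariant, not only up to a scalar.
\<close>

lemma local_series_denominator:
  fixes f :: "('n::finite, 'k::field) mps"
  assumes "f \<in> local_series"
  obtains q where "q \<in> polys" "mps_nth q 0 = 1" "q * f \<in> polys"
proof -
  obtain q where q: "q \<in> polys" "mps_nth q 0 \<noteq> 0" "q * f \<in> polys"
    using assms by (auto simp: local_series_def)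
  define s :: "('n, 'k) mps"
    where "s = mps_of_poly (Poly_Mapping.single 0 (inverse (mps_nth q 0)))"
  have s: "s \<in> polys" "mps_nth s 0 = inverse (mps_nth q 0)"
    by (simp_all add: s_def polysI mps_nth_of_poly)
  show thesis
  proof (rule that[of "s * q"])
    show "s * q * f \<in> polys" using polys_mult[OF s(1) q(3)] by (simp add: mult.assoc)
  qed (use s q in \<open>simp_all add: polys_mult mps_nth_mult_0\<close>)
qed

lemma local_hull_clear_denominator:
  fixes I :: "('n::finite, 'k::field) mps set"
  assumes I: "left_ideal polys I" and f: "f \<in> left_ideal local_series hull I"
  obtains q where "q \<in> polys" "mps_nth q 0 = 1" "q * f \<in> I"
proof -
  let ?K = "{f \<in> local_series. \<exists>q\<in>polys. mps_nth q 0 = 1 \<and> q * f \<in> I}"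
  have smult: "r * a \<in> I" if "r \<in> polys" "a \<in> I" for r a :: "('n, 'k) mps"
    using I that by (auto simp: left_ideal_def)
  have "I \<subseteq> ?K"
    using I polys_subset_local polys_1
    by (auto simp: left_ideal_def one_mps.rep_eq intro!: bexI[of _ 1])
  moreover have "left_ideal local_series ?K"
    unfolding left_ideal_def
  proof (intro conjI ballI)
    show "0 \<in> ?K" using \<open>I \<subseteq> ?K\<close> I by (auto simp: left_ideal_def)
  next
    fix f g :: "('n, 'k) mps" assume "f \<in> ?K" "g \<in> ?K"
    then obtain q r where q: "q \<in> polys" "mps_nth q 0 = 1" "q * f \<in> I"
      and r: "r \<in> polys" "mps_nth r 0 = 1" "r * g \<in> I"
      and loc: "f \<in> local_series" "g \<in> local_series" by auto
    have "q * r * (f + g) = r * (q * f) + q * (r * g)" by (simp add: algebra_simps)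
    also have "\<dots> \<in> I" using I smult q r by (auto simp: left_ideal_def)
    finally show "f + g \<in> ?K"
      using loc q r by (auto intro!: local_add polys_mult bexI[of _ "q * r"] simp: mps_nth_mult_0)
  next
    fix c f :: "('n, 'k) mps" assume c: "c \<in> local_series" and "f \<in> ?K"
    then obtain q where q: "q \<in> polys" "mps_nth q 0 = 1" "q * f \<in> I" "f \<in> local_series" by auto
    obtain r where r: "r \<in> polys" "mps_nth r 0 = 1" "r * c \<in> polys"
      using local_series_denominator[OF c] .
    have "r * q * (c * f) = (r * c) * (q * f)" by (simp add: algebra_simps)
    also have "\<dots> \<in> I" using smult r q by auto
    finally show "c * f \<in> ?K"
      using c q r by (auto intro!: local_mult polys_mult bexI[of _ "r * q"] simp: mps_nth_mult_0)
  qed auto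
  ultimately have "left_ideal local_series hull I \<subseteq> ?K" by (rule hull_minimal)
  then show thesis using f that by auto
qed

lemma op_const_in_diffops_over: "0 \<in> C \<Longrightarrow> c \<in> C \<Longrightarrow> op_const c \<in> diffops_over C"
  by (auto simp: diffops_over_def op_coeff_def op_const_def Diffop_inverse lookup_single when_def)

lemma op_partial_in_diffops_over:
  "0 \<in> C \<Longrightarrow> 1 \<in> C \<Longrightarrow> op_partial i \<in> diffops_over C"
  by (auto simp: diffops_over_def op_coeff_def op_partial_def Diffop_inverse lookup_single when_def)

text \<open>
  The factor \<open>q\<close> on the right can be absorbed into an operator \<open>P\<close> whose denominator is \<open>q\<close>;
  the remaining left factor has polynomial coefficients if \<open>q\<close> is a polynomial.
\<close>

lemma Ore_identity:
  "op_const (q * q) * op_partial i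
    = (op_const q * op_partial i + op_const (- mps_deriv i q)) * op_const q"
proof -
  have neg: "op_const (- c) = - op_const c" for c :: "('a, 'b) mps"
  proof -
    have "op_const (0 :: ('a, 'b) mps) = 0"
      by (rule diffop_eqI) (simp add: op_const_def Diffop_inverse zero_diffop.rep_eq)
    then have "op_const (- c) + op_const c = 0"
      by (simp add: op_const_add[symmetric])
    then show ?thesis by (simp add: eq_neg_iff_add_eq_0)
  qed
  have "op_partial i * op_const q = op_const q * op_partial i + op_const (mps_deriv i q)"
    using op_partial_const[of i q] by (simp add: algebra_simps)
  then have "op_const q * op_partial i * op_const q
      = op_const (q * q) * op_partial i + op_const (q * mps_deriv i q)"
    by (simp add: mult.assoc op_const_mult distrib_left)
  moreover have "op_const (mps_deriv i q) * op_const q = op_const (q * mps_deriv i q)"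
    by (simp add: op_const_mult[symmetric] mult.commute)
  ultimately show ?thesis by (simp add: neg left_diff_distrib)
qed

text \<open>
  Since \<open>R P\<close> is the sum of the \<open>c\<^sub>\<beta> (\<partial>\<^sup>\<beta> P)\<close> for the coefficients \<open>c\<^sub>\<beta>\<close> of \<open>R\<close>, a set closed
  under addition need only be tested against the generators of the ring of operators.
\<close>

lemma diffops_over_mult_closed:
  fixes K :: "('n::finite, 'k::comm_ring_1) diffop set"
  assumes zero: "0 \<in> K" and add: "\<And>P Q. P \<in> K \<Longrightarrow> Q \<in> K \<Longrightarrow> P + Q \<in> K"
    and const: "\<And>c P. c \<in> C \<Longrightarrow> P \<in> K \<Longrightarrow> op_const c * P \<in> K"
    and partial: "\<And>i P. P \<in> K \<Longrightarrow> op_partial i * P \<in> K"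
    and R: "R \<in> diffops_over C" and P: "P \<in> K"
  shows "R * P \<in> K"
proof -
  let ?d = "\<lambda>\<beta>. Diffop (nf_partial_power \<beta> (normal_form P))"
  have d: "?d \<beta> \<in> K" for \<beta>
  proof (induction \<beta> rule: exponent_induct)
    case zero
    then show ?case using P by (simp add: normal_form_inverse)
  next
    case (Suc \<beta> i)
    have "op_partial i * ?d \<beta> = ?d (\<beta> + Poly_Mapping.single i 1)"
      by (rule diffop_eqI) (simp only: normal_form_partial_mult nf_partial_power_Suc Diffop_inverse UNIV_I)
    then show ?case using partial[OF Suc, of i] by (simp only:)
  qed
  let ?s = "\<lambda>B. \<Sum>\<beta>\<in>B. op_const (op_coeff R \<beta>) * ?d \<beta>"
  have nf: "normal_form (?s B)
      = (\<Sum>\<beta>\<in>B. Poly_Mapping.single 0 (op_coeff R \<beta>) * nf_partial_power \<beta> (normal_form P))"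
    for B :: "('n \<Rightarrow>\<^sub>0 nat) set"
    by (induction B rule: infinite_finite_induct)
      (simp_all add: zero_diffop.rep_eq plus_diffop.rep_eq normal_form_const_mult Diffop_inverse)
  have "R * P = ?s (Poly_Mapping.keys (normal_form R))"
    by (rule diffop_eqI) (simp only: nf times_diffop.rep_eq nf_mult_def, simp only: op_coeff_def)
  moreover have "?s B \<in> K" for B :: "('n \<Rightarrow>\<^sub>0 nat) set"
    using R d
    by (induction B rule: infinite_finite_induct) (auto simp: diffops_over_def intro!: zero add const)
  ultimately show ?thesis by simp
qed

lemma local_diffops_hull_clear_denominator:
  fixes J :: "('n::finite, 'k::field) diffop set"
  assumes J: "left_ideal poly_diffops J" and P: "P \<in> left_ideal local_diffops hull J"
  obtains q where "q \<in> polys" "mps_nth q 0 = 1" "op_const q * P \<in> J"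
proof -
  let ?K = "{P \<in> local_diffops. \<exists>q\<in>polys. mps_nth q 0 = 1 \<and> op_const q * P \<in> J}"
  note ring = left_ideal_rings(3,4)[where ?'n = 'n and ?'k = 'k, unfolded left_ideal_def]
  have loc_01: "0 \<in> (local_series :: ('n, 'k) mps set)" "1 \<in> (local_series :: ('n, 'k) mps set)"
    using polys_subset_local polys_0 polys_1 by auto
  have Jmult: "R * Q \<in> J" if "R \<in> poly_diffops" "Q \<in> J" for R Q
    using J that by (auto simp: left_ideal_def)
  have Jconst: "op_const c * Q \<in> J" if "c \<in> polys" "Q \<in> J" for c Q
    using that by (auto intro: Jmult op_const_in_diffops_over polys_0)
  have "J \<subseteq> ?K"
    using J polys_subset_local polys_1
    by (auto simp: left_ideal_def diffops_over_def one_mps.rep_eq op_const_1 intro!: bexI[of _ 1])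
  have K0: "0 \<in> ?K" using \<open>J \<subseteq> ?K\<close> J by (auto simp: left_ideal_def)
  have K_add: "P + Q \<in> ?K" if "P \<in> ?K" "Q \<in> ?K" for P Q
  proof -
    obtain q r where q: "q \<in> polys" "mps_nth q 0 = 1" "op_const q * P \<in> J"
      and r: "r \<in> polys" "mps_nth r 0 = 1" "op_const r * Q \<in> J"
      and loc: "P \<in> local_diffops" "Q \<in> local_diffops" using \<open>P \<in> ?K\<close> \<open>Q \<in> ?K\<close> by auto
    have "op_const (q * r) * (P + Q) = op_const (r * q) * P + op_const (q * r) * Q"
      by (simp add: distrib_left mult.commute)
    also have "\<dots> = op_const r * (op_const q * P) + op_const q * (op_const r * Q)"
      by (simp only: op_const_mult mult.assoc)
    also have "\<dots> \<in> J" using J Jconst q r by (auto simp: left_ideal_def)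
    finally show ?thesis
      using loc q r ring by (auto intro!: polys_mult bexI[of _ "q * r"] simp: mps_nth_mult_0)
  qed
  have K_const: "op_const c * P \<in> ?K" if c: "c \<in> local_series" and "P \<in> ?K" for c P
  proof -
    obtain q where q: "q \<in> polys" "mps_nth q 0 = 1" "op_const q * P \<in> J" "P \<in> local_diffops"
      using \<open>P \<in> ?K\<close> by auto
    obtain r where r: "r \<in> polys" "mps_nth r 0 = 1" "r * c \<in> polys"
      using local_series_denominator[OF c] .
    have "op_const (r * q) * (op_const c * P) = op_const (r * q * c) * P"
      by (simp only: op_const_mult mult.assoc)
    also have "\<dots> = op_const (r * c * q) * P" by (simp only: mult.assoc mult.commute[of q c])
    also have "\<dots> = op_const (r * c) * (op_const q * P)" by (simp only: op_const_mult mult.assoc)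
    also have "\<dots> \<in> J" using Jconst r q by auto
    finally show ?thesis
      using c q r ring op_const_in_diffops_over[OF loc_01(1) c]
      by (auto intro!: polys_mult bexI[of _ "r * q"] simp: mps_nth_mult_0)
  qed
  have K_partial: "op_partial i * P \<in> ?K" if "P \<in> ?K" for i P
  proof -
    obtain q where q: "q \<in> polys" "mps_nth q 0 = 1" "op_const q * P \<in> J" "P \<in> local_diffops"
      using \<open>P \<in> ?K\<close> by auto
    have "op_const q * op_partial i + op_const (- mps_deriv i q) \<in> poly_diffops"
      using ring(1) q(1)
      by (auto intro!: op_const_in_diffops_over op_partial_in_diffops_over polys_0 polys_1
          polys_uminus polys_deriv)
    from Jmult[OF this q(3)] have "op_const (q * q) * (op_partial i * P) \<in> J"
      by (simp only: mult.assoc[symmetric] Ore_identity)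
    then show ?thesis
      using q ring op_partial_in_diffops_over[OF loc_01, of i]
      by (auto intro!: polys_mult bexI[of _ "q * q"] simp: mps_nth_mult_0)
  qed
  have "left_ideal local_diffops ?K"
    unfolding left_ideal_def
    using K0 K_add diffops_over_mult_closed[of ?K local_series, OF K0 K_add K_const K_partial] by blast
  with \<open>J \<subseteq> ?K\<close> have "left_ideal local_diffops hull J \<subseteq> ?K" by (rule hull_minimal)
  then show thesis using P that by auto
qed

section \<open>Invariance of the open Groebner fans under localization\<close>

lemma open_fan_cong:
  assumes "\<And>w. w \<in> U \<Longrightarrow> ini w ` I = ini w ` I'"
  shows "open_fan ini I U = open_fan ini I' U"
proof -
  have "{(w, w'). w \<in> U \<and> w' \<in> U \<and> initial_ideal (ini w) I = initial_ideal (ini w') I}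
      = {(w, w'). w \<in> U \<and> w' \<in> U \<and> initial_ideal (ini w) I' = initial_ideal (ini w') I'}"
    using assms by (auto simp: initial_ideal_def)
  then show ?thesis by (simp add: open_fan_def)
qed

theorem corollary4p1p6:
  fixes I :: "('n::finite, 'k::field) mps set" and J :: "('n, 'k) diffop set"
  assumes "left_ideal polys I" and "left_ideal poly_diffops J"
  shows "open_fan in_u I U_loc = open_fan in_u (left_ideal local_series hull I) U_loc \<and>
    open_fan in_w J W_loc = open_fan in_w (left_ideal local_diffops hull J) W_loc"
proof
  show "open_fan in_u I U_loc = open_fan in_u (left_ideal local_series hull I) U_loc"
  proof (rule open_fan_cong)
    fix u :: "real ^ 'n" assume u: "u \<in> U_loc"
    have "in_u u f \<in> in_u u ` I" if "f \<in> left_ideal local_series hull I" for f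
      using local_hull_clear_denominator[OF assms(1) that] in_u_mult_unit[OF u] by (metis imageI)
    then show "in_u u ` I = in_u u ` (left_ideal local_series hull I)"
      using hull_subset[of I "left_ideal local_series"] by blast
  qed
  show "open_fan in_w J W_loc = open_fan in_w (left_ideal local_diffops hull J) W_loc"
  proof (rule open_fan_cong)
    fix w :: "(real ^ 'n) \<times> (real ^ 'n)" assume w: "w \<in> W_loc"
    have "in_w w P \<in> in_w w ` J" if "P \<in> left_ideal local_diffops hull J" for P
      using local_diffops_hull_clear_denominator[OF assms(2) that] in_w_mult_unit[OF w]
      by (metis imageI)
    then show "in_w w ` J = in_w w ` (left_ideal local_diffops hull J)"
      using hull_subset[of J "left_ideal local_diffops"] by blast
  qed
qed

end
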